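(* Let $d\ge1$. Let $\mathcal{L}:[0,\infty)\to[1,\infty)$ be monotone increasing with $\mathcal{L}(0)=1$ and $M:=1+\int_0^\infty\frac{dt}{(t+1)\mathcal{L}(t)}<\infty$, and suppose that $(t+1)\ln\mathcal{L}(t)$ is convex on $[0,\infty)$. Then, for each of the types (a), (b), (c), the set $$\mathcal{S}\big(d,\mathcal{L};8,\,10d(2d-1)M(8(d+2)M+1)\big)$$ contains an admissible cutoff function $\hat A$, $0\le\hat A\le1$, of second kind and of that type.
   Context: For $\gamma,\tilde\gamma>0$, $\mathcal{S}(d,\mathcal{L};\gamma,\tilde\gamma)$ is the set of all $\hat A\in C^\infty[0,\infty)^d$ with $\|\hat A\|_\infty\le\gamma$ and $\frac1{k!}\|D_j^k\hat A\|_\infty\le\gamma(\tilde\gamma\mathcal{L}(k-1))^k$ for all $k\in\mathbb{N}$, $1\le j\le d$, where $D_j^k=\partial^k/\partial t_j^k$. Let $\operatorname{proj}_k t$ denote $t\in\mathbb{R}^d$ with its $k$th coordinate replaced by $0$, and $\mathcal{B}_1=\{t\in[0,\infty)^d:\|t\|_1\le1\}$. A function $\hat A\in C^\infty[0,\infty)^d$ is an admissible cutoff function of second kind and type (a), (b) or (c) if $\operatorname{supp}\hat A\subset[0,2]^d$, $\hat A(t)=\hat A(\operatorname{proj}_k t)$ for every $t\in[0,\infty)^d$ and every $k$ such that $t_k\le\frac12\|t\|_\infty$, and, respectively: (a) $\hat A(t)=1$ if $t\in\mathcal{B}_1$; (b) $\hat A(t)=0$ if $t\in\frac12\mathcal{B}_1$;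 (c) $\hat A$ is of type (b) and $\sum_{j=0}^\infty|\hat A(2^{-j}t)|^2=1$ for $t\in[0,\infty)^d\setminus[0,1)^d$. *)

theory Defs
  imports "HOL-Analysis.Analysis"
begin

text \<open>
  Throughout, \<open>d = CARD('n)\<close>, and a function on the orthant \<open>[0,\<infinity>)\<^sup>d\<close> is represented by a total
  function on \<^typ>\<open>real^'n\<close>. Nothing below depends on its values outside the orthant.
\<close>

definition orthant :: "(real^'n) set" where
  "orthant = {t. \<forall>i. 0 \<le> t $ i}"

definition set_coord :: "'n \<Rightarrow> real \<Rightarrow> real^'n \<Rightarrow> real^'n" where
  "set_coord j s t = (\<chi> i. if i = j then s else t $ i)"

text \<open>
  The partial derivative with respect to \<open>t\<^sub>j\<close>. It is taken within \<open>[0,\<infinity>)\<close>, so it is the two-sided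
  one where \<open>t $ j > 0\<close> and the right-hand one where \<open>t $ j = 0\<close>.
\<close>

definition pderiv_at :: "'n \<Rightarrow> (real^'n \<Rightarrow> real) \<Rightarrow> real^'n \<Rightarrow> real" where
  "pderiv_at j f t =
     vector_derivative (\<lambda>s. f (set_coord j s t)) (at (t $ j) within {0..})"

definition pdifferentiable :: "'n \<Rightarrow> (real^'n \<Rightarrow> real) \<Rightarrow> bool" where
  "pdifferentiable j f \<longleftrightarrow>
     (\<forall>t\<in>orthant. (\<lambda>s. f (set_coord j s t)) differentiable (at (t $ j) within {0..}))"

text \<open>
  \<open>C_orthant m f\<close> states that all iterated (mixed) partial derivatives of \<open>f\<close> of order at most \<open>m\<close>
  exist and are continuous on the whole closed orthant.
\<close>

primrec C_orthant :: "nat \<Rightarrow> (real^'n \<Rightarrow> real) \<Rightarrow> bool" where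
  "C_orthant 0 f \<longleftrightarrow> continuous_on orthant f"
| "C_orthant (Suc m) f \<longleftrightarrow>
     continuous_on orthant f \<and> (\<forall>j. pdifferentiable j f \<and> C_orthant m (pderiv_at j f))"

definition smooth_orthant :: "(real^'n \<Rightarrow> real) \<Rightarrow> bool" where
  "smooth_orthant f \<longleftrightarrow> (\<forall>m. C_orthant m f)"

text \<open>The supremum norm on the orthant; extended-valued, as \<open>f\<close> need not be bounded.\<close>

definition sup_norm :: "(real^'n \<Rightarrow> real) \<Rightarrow> ereal" where
  "sup_norm f = (SUP t\<in>orthant. ereal \<bar>f t\<bar>)"

definition S_class :: "(real \<Rightarrow> real) \<Rightarrow> real \<Rightarrow> real \<Rightarrow> (real^'n \<Rightarrow> real) set" where
  "S_class L \<gamma> \<gamma>' =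
     {A. smooth_orthant A \<and>
         sup_norm A \<le> ereal \<gamma> \<and>
         (\<forall>k::nat. \<forall>j. 1 \<le> k \<longrightarrow>
            ereal (1 / fact k) * sup_norm ((pderiv_at j ^^ k) A)
              \<le> ereal (\<gamma> * (\<gamma>' * L (real k - 1)) ^ k))}"

definition proj :: "'n \<Rightarrow> real^'n \<Rightarrow> real^'n" where
  "proj k t = set_coord k 0 t"

definition l1_norm :: "real^'n \<Rightarrow> real" where
  "l1_norm t = (\<Sum>i\<in>UNIV. \<bar>t $ i\<bar>)"

definition B1 :: "(real^'n) set" where
  "B1 = {t \<in> orthant. l1_norm t \<le> 1}"

text \<open>The part of the definition common to the three types; \<^const>\<open>infnorm\<close> is the maximum norm.\<close>

definition cutoff_second_kind :: "(real^'n \<Rightarrow> real) \<Rightarrow> bool" where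
  "cutoff_second_kind A \<longleftrightarrow>
     smooth_orthant A \<and>
     closure (support_on orthant A) \<subseteq> {t. \<forall>i. 0 \<le> t $ i \<and> t $ i \<le> 2} \<and>
     (\<forall>t\<in>orthant. \<forall>k. t $ k \<le> 1 / 2 * infnorm t \<longrightarrow> A t = A (proj k t))"

definition cutoff_a :: "(real^'n \<Rightarrow> real) \<Rightarrow> bool" where
  "cutoff_a A \<longleftrightarrow> cutoff_second_kind A \<and> (\<forall>t\<in>B1. A t = 1)"

definition cutoff_b :: "(real^'n \<Rightarrow> real) \<Rightarrow> bool" where
  "cutoff_b A \<longleftrightarrow> cutoff_second_kind A \<and> (\<forall>t\<in>(\<lambda>t. (1 / 2) *\<^sub>R t) ` B1. A t = 0)"

definition cutoff_c :: "(real^'n \<Rightarrow> real) \<Rightarrow> bool" where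
  "cutoff_c A \<longleftrightarrow> cutoff_b A \<and>
     (\<forall>t \<in> orthant - {t. \<forall>i. 0 \<le> t $ i \<and> t $ i < 1}.
        (\<lambda>j::nat. \<bar>A ((1 / 2 ^ j) *\<^sub>R t)\<bar>\<^sup>2) sums 1)"

end

theory Submission
  imports Defs "HOL-Computational_Algebra.Formal_Power_Series"
begin

text \<open>
  Everything is built from one smooth step \<open>g\<close> on the line, with \<open>g = 1\<close> on \<open>(-\<infinity>,1]\<close>,
  \<open>g = 0\<close> on \<open>[2,\<infinity>)\<close>, and \<open>\<bar>g\<^sup>(\<^sup>k\<^sup>)\<bar> / k! \<le> (4 M L(k - 1))\<^sup>k\<close>. Such a step exists because the
  finiteness of \<open>M\<close> excludes quasi-analyticity. Averaging a ramp successively over intervals of lengths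
  \<open>w\<^sub>i = 1 / (2 M (i + 1) L(i))\<close> costs only the total length \<open>\<Sum> w\<^sub>i \<le> 1/2\<close>, and each average turns
  one derivative into a difference quotient of step \<open>w\<^sub>i\<close>, so that the \<open>k\<close>-th derivative is at most
  \<open>\<Prod>i<k. 2 / w\<^sub>i\<close>, which is \<open>(4 M)\<^sup>k k! L(0) \<cdots> L(k - 1)\<close>. The lemmas are \<open>box_step_tower\<close>,
  \<open>sum_box_widths_le\<close> and \<open>jet_weight_step\<close>.

  The function \<open>G t = \<Prod>i. g (t\<^sub>i)\<close> is a cutoff of type (a). It is of the second kind because a
  coordinate \<open>t\<^sub>k\<close> not exceeding half of the largest one does not affect the value: either the largest
  coordinate is at least \<open>2\<close>, and \<open>G\<close> vanishes, or \<open>t\<^sub>k \<le> 1\<close>, and its factor is \<open>1\<close>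
  (lemma \<open>cube_step_proj\<close>).

  For type (c) one needs \<open>A\<^sup>2 = B t - B (2 t)\<close> with \<open>B\<close> of type (a), for then the dyadic sum
  telescopes. Since \<open>B = 1\<close> wherever \<open>B (2 t) \<noteq> 0\<close>, the right-hand side is \<open>B t (1 - B (2 t))\<close>, and
  what is needed is that both \<open>B\<close> and \<open>1 - B\<close> have smooth square roots. This is arranged by
  \<open>B = cos\<^sup>2 \<theta>\<close> with the angle \<open>\<theta> = \<pi>/2 (1 - G)\<close>, giving \<open>A t = cos (\<theta> t) sin (\<theta> (2 t))\<close>. The same
  function serves for type (b).

  It remains to bound pure derivatives, a one-variable question: along a coordinate line \<open>G\<close> is
  a constant in \<open>[0,1]\<close> times \<open>g\<close>. Monotonicity of \<open>L\<close> makes the weights \<open>N\<^sub>k = L(k - 1)\<^sup>k\<close>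
  submultiplicative in the sense \<open>N\<^sub>i N\<^sub>j \<le> N\<^sub>i\<^sub>+\<^sub>j\<close>; hence bounds \<open>q\<^sup>k N\<^sub>k\<close> on Taylor coefficients are
  preserved, with a larger \<open>q\<close>, by products and by cosine and sine (\<open>taylor_bounded_mult\<close>,
  \<open>taylor_bounded_cos_sin\<close>). For \<open>A\<close> the resulting constant is \<open>q = 48 M\<close>, and \<open>\<gamma>' \<ge> 240 M\<close>.
\<close>

section \<open>Taylor series of smooth functions of one variable\<close>

unbundle no vec_syntax
unbundle fps_syntax

definition smooth_line :: "(real \<Rightarrow> real) \<Rightarrow> bool" where
  "smooth_line f \<longleftrightarrow>
     (\<forall>k x. ((deriv ^^ k) f has_real_derivative (deriv ^^ Suc k) f x) (at x))"

text \<open>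
  The series of normalised derivatives, kept as a formal power series so that the Leibniz rule
  becomes multiplication of series and need not be stated with binomial coefficients.
\<close>

definition taylor_fps :: "(real \<Rightarrow> real) \<Rightarrow> real \<Rightarrow> real fps" where
  "taylor_fps f x = Abs_fps (\<lambda>k. (deriv ^^ k) f x / fact k)"

lemma taylor_fps_nth [simp]: "taylor_fps f x $ k = (deriv ^^ k) f x / fact k"
  by (simp add: taylor_fps_def)

text \<open>
  All iterated derivatives are identified at once by exhibiting a candidate sequence in which each
  function is differentiable with the next one as its derivative.
\<close>

lemma higher_deriv_eqI:
  fixes D :: "nat \<Rightarrow> real \<Rightarrow> real"
  assumes D: "\<And>k x. (D k has_real_derivative D (Suc k) x) (at x)"
  shows "(deriv ^^ k) (D 0) = D k" and "smooth_line (D 0)"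
proof -
  have *: "(deriv ^^ k) (D 0) = D k" for k
  proof (induction k)
    case (Suc k)
    have "deriv (D k) = D (Suc k)"
      using D by (intro ext DERIV_imp_deriv)
    with Suc show ?case by simp
  qed simp
  show "(deriv ^^ k) (D 0) = D k" by (rule *)
  show "smooth_line (D 0)"
    unfolding smooth_line_def * by (blast intro: D)
qed

lemma smooth_lineD:
  "smooth_line f \<Longrightarrow> ((deriv ^^ k) f has_real_derivative (deriv ^^ Suc k) f x) (at x)"
  unfolding smooth_line_def by blast

lemma Suc_mult_div_fact_Suc: "real (Suc k) * a / fact (Suc k) = a / fact k" for a :: real
  unfolding fact_Suc by (simp del: of_nat_Suc)

lemma smooth_line_deriv:
  assumes "smooth_line f"
  shows "smooth_line (deriv f)" and "taylor_fps (deriv f) x = fps_deriv (taylor_fps f x)"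
    and "(f has_real_derivative deriv f x) (at x)"
proof -
  show "smooth_line (deriv f)"
    unfolding smooth_line_def
    using smooth_lineD[OF assms, of "Suc _"] by (simp add: funpow_swap1)
  show "taylor_fps (deriv f) x = fps_deriv (taylor_fps f x)"
    by (rule fps_ext)
      (simp add: Suc_mult_div_fact_Suc funpow_swap1 del: of_nat_Suc fact_Suc)
  show "(f has_real_derivative deriv f x) (at x)"
    using smooth_lineD[OF assms, of 0] by simp
qed

text \<open>
  A family of series is the family of Taylor series of its constant terms as soon as
  differentiating the coefficients in the base point agrees with \<^const>\<open>fps_deriv\<close>.
\<close>

lemma taylor_fps_eqI:
  assumes J: "\<And>k x. ((\<lambda>x. J x $ k) has_real_derivative fps_deriv (J x) $ k) (at x)"
    and J0: "\<And>x. J x $ 0 = f x"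
  shows "smooth_line f" and "taylor_fps f x = J x"
proof -
  define D where "D k x = fact k * J x $ k" for k x
  have D: "(D k has_real_derivative D (Suc k) x) (at x)" for k x
    unfolding D_def using DERIV_cmult[OF J[of k x], of "fact k"] by (simp add: algebra_simps)
  have f: "f = D 0" using J0 by (auto simp: D_def)
  show "smooth_line f" unfolding f by (rule higher_deriv_eqI) (rule D)
  have "(deriv ^^ k) f x = D k x" for k
    unfolding f using higher_deriv_eqI(1)[of D k] D by simp
  then show "taylor_fps f x = J x"
    by (intro fps_ext) (simp add: D_def)
qed

text \<open>
  The Leibniz rule: both sides satisfy the criterion \<open>taylor_fps_eqI\<close>, since \<^const>\<open>fps_deriv\<close> is
  a derivation.
\<close>

lemma smooth_line_mult:
  assumes f: "smooth_line f" and g: "smooth_line g"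
  shows "smooth_line (\<lambda>x. f x * g x)"
    and "taylor_fps (\<lambda>x. f x * g x) x = taylor_fps f x * taylor_fps g x"
proof -
  have nth: "((\<lambda>x. taylor_fps h x $ k) has_real_derivative fps_deriv (taylor_fps h x) $ k) (at x)"
    if "smooth_line h" for h k x
    using DERIV_cdivide[OF smooth_lineD[OF that, of k x], of "fact k"]
    by (simp add: Suc_mult_div_fact_Suc del: of_nat_Suc fact_Suc)
  have *: "((\<lambda>x. (taylor_fps f x * taylor_fps g x) $ k) has_real_derivative
           fps_deriv (taylor_fps f x * taylor_fps g x) $ k) (at x)" for k x
  proof -
    have "((\<lambda>x. \<Sum>i=0..k. taylor_fps f x $ i * taylor_fps g x $ (k - i)) has_real_derivative
           (\<Sum>i=0..k. taylor_fps f x $ i * fps_deriv (taylor_fps g x) $ (k - i)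
              + fps_deriv (taylor_fps f x) $ i * taylor_fps g x $ (k - i))) (at x)"
      by (intro DERIV_sum DERIV_mult' nth f g)
    then show ?thesis
      unfolding fps_mult_nth fps_deriv_mult fps_add_nth
      by (simp only: sum.distrib)
  qed
  show "smooth_line (\<lambda>x. f x * g x)"
    by (rule taylor_fps_eqI[OF *]) simp
  show "taylor_fps (\<lambda>x. f x * g x) x = taylor_fps f x * taylor_fps g x"
    by (rule taylor_fps_eqI[OF *]) simp
qed

lemma smooth_line_affine_out:
  assumes f: "smooth_line f"
  shows "smooth_line (\<lambda>x. \<alpha> + \<beta> * f x)"
    and "k > 0 \<Longrightarrow> (deriv ^^ k) (\<lambda>x. \<alpha> + \<beta> * f x) x = \<beta> * (deriv ^^ k) f x"
proof -
  define D where "D k x = (if k = 0 then \<alpha> else 0) + \<beta> * (deriv ^^ k) f x" for k x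
  have D: "(D k has_real_derivative D (Suc k) x) (at x)" for k x
    unfolding D_def
    by (rule DERIV_cong, rule DERIV_add[OF DERIV_const DERIV_cmult[OF smooth_lineD[OF f]]]) simp
  have D0: "D 0 = (\<lambda>x. \<alpha> + \<beta> * f x)" by (auto simp: D_def)
  show "smooth_line (\<lambda>x. \<alpha> + \<beta> * f x)"
    and "k > 0 \<Longrightarrow> (deriv ^^ k) (\<lambda>x. \<alpha> + \<beta> * f x) x = \<beta> * (deriv ^^ k) f x"
    using higher_deriv_eqI[of D, OF D] by (auto simp: D_def[abs_def])
qed

lemma smooth_line_affine_in:
  assumes f: "smooth_line f"
  shows "smooth_line (\<lambda>x. f (\<alpha> + c * x))"
    and "(deriv ^^ k) (\<lambda>x. f (\<alpha> + c * x)) x = c ^ k * (deriv ^^ k) f (\<alpha> + c * x)"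
proof -
  define D where "D k x = c ^ k * (deriv ^^ k) f (\<alpha> + c * x)" for k x
  have D: "(D k has_real_derivative D (Suc k) x) (at x)" for k x
  proof -
    have "((\<lambda>x. \<alpha> + c * x) has_real_derivative c) (at x)"
      by (auto intro!: derivative_eq_intros)
    from DERIV_cmult[OF DERIV_chain2[OF smooth_lineD[OF f] this], of "c ^ k" k]
    show ?thesis unfolding D_def by (simp add: algebra_simps)
  qed
  have D0: "D 0 = (\<lambda>x. f (\<alpha> + c * x))" by (auto simp: D_def)
  show "smooth_line (\<lambda>x. f (\<alpha> + c * x))"
    and "(deriv ^^ k) (\<lambda>x. f (\<alpha> + c * x)) x = c ^ k * (deriv ^^ k) f (\<alpha> + c * x)"
    using higher_deriv_eqI[of D, OF D] unfolding D0 by (auto simp: D_def)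
qed

section \<open>Weighted bounds on Taylor coefficients\<close>

definition taylor_bounded :: "(nat \<Rightarrow> real) \<Rightarrow> real \<Rightarrow> (real \<Rightarrow> real) \<Rightarrow> bool" where
  "taylor_bounded N q f \<longleftrightarrow> (\<forall>k x. \<bar>taylor_fps f x $ k\<bar> \<le> q ^ k * N k)"

text \<open>
  The Cauchy product has \<open>k + 1\<close> terms of the same size, and \<open>k + 1 \<le> 2\<^sup>k\<close>.
\<close>

lemma taylor_bounded_mult:
  assumes N: "\<And>k. 0 \<le> N k" "\<And>i j. N i * N j \<le> N (i + j)" and q: "0 \<le> q"
    and f: "smooth_line f" "taylor_bounded N q f"
    and g: "smooth_line g" "taylor_bounded N q g"
  shows "taylor_bounded N (2 * q) (\<lambda>x. f x * g x)"
  unfolding taylor_bounded_def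
proof (intro allI)
  fix k x
  have "\<bar>taylor_fps (\<lambda>x. f x * g x) x $ k\<bar>
      \<le> (\<Sum>i=0..k. \<bar>taylor_fps f x $ i\<bar> * \<bar>taylor_fps g x $ (k - i)\<bar>)"
    unfolding smooth_line_mult(2)[OF f(1) g(1)] fps_mult_nth abs_mult[symmetric]
    by (rule sum_abs)
  also have "\<dots> \<le> (\<Sum>i=0..k. q ^ k * N k)"
  proof (rule sum_mono)
    fix i assume "i \<in> {0..k}"
    then have i: "k = i + (k - i)" by simp
    have "\<bar>taylor_fps f x $ i\<bar> * \<bar>taylor_fps g x $ (k - i)\<bar>
        \<le> (q ^ i * N i) * (q ^ (k - i) * N (k - i))"
      using f(2) g(2) N(1) q unfolding taylor_bounded_def by (intro mult_mono) auto
    also have "\<dots> = q ^ k * (N i * N (k - i))"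
      by (subst (3) i) (simp add: power_add)
    also have "\<dots> \<le> q ^ k * N k"
      using N(2)[of i "k - i"] i q by (intro mult_left_mono) auto
    finally show "\<bar>taylor_fps f x $ i\<bar> * \<bar>taylor_fps g x $ (k - i)\<bar> \<le> q ^ k * N k" .
  qed
  also have "\<dots> = real (Suc k) * (q ^ k * N k)" by simp
  also have "\<dots> \<le> 2 ^ k * (q ^ k * N k)"
  proof (rule mult_right_mono)
    have "Suc k \<le> 2 ^ k" by (rule Suc_leI) (rule less_exp)
    then show "real (Suc k) \<le> 2 ^ k"
      by (metis of_nat_le_iff of_nat_numeral of_nat_power)
  qed (use N(1) q in auto)
  finally show "\<bar>taylor_fps (\<lambda>x. f x * g x) x $ k\<bar> \<le> (2 * q) ^ k * N k"
    by (simp add: power_mult_distrib mult.assoc)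
qed

text \<open>
  The differential equations \<open>(cos u)' = - u' sin u\<close> and \<open>(sin u)' = u' cos u\<close> express the
  coefficient \<open>k + 1\<close> of one function through the lower ones of the other, which replaces a formula
  for the derivatives of a composition. The constant \<open>q = (1 + a) b\<close> reproduces itself in the
  induction because \<open>a b = q - b\<close> makes the convolution telescope to \<open>q\<^sup>k\<^sup>+\<^sup>1 - b\<^sup>k\<^sup>+\<^sup>1\<close>.
\<close>

lemma taylor_bounded_cos_sin:
  assumes N: "\<And>k. 0 \<le> N k" "N 0 = 1" "\<And>i j. N i * N j \<le> N (i + j)"
    and ab: "0 \<le> a" "0 \<le> b"
    and u: "smooth_line u"
    and bd: "\<And>k x. k > 0 \<Longrightarrow> \<bar>taylor_fps u x $ k\<bar> \<le> a * b ^ k * N k"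
    and cs: "smooth_line (\<lambda>x. cos (u x))" "smooth_line (\<lambda>x. sin (u x))"
  shows "taylor_bounded N ((1 + a) * b) (\<lambda>x. cos (u x))"
    and "taylor_bounded N ((1 + a) * b) (\<lambda>x. sin (u x))"
proof -
  define q where "q = (1 + a) * b"
  have q: "0 \<le> q" using ab by (simp add: q_def)
  define X where "X = taylor_fps (\<lambda>x. cos (u x))"
  define Y where "Y = taylor_fps (\<lambda>x. sin (u x))"
  define U where "U = taylor_fps u"
  have u': "(u has_real_derivative deriv u x) (at x)" for x
    using smooth_line_deriv(3)[OF u] .
  have "deriv (\<lambda>x. cos (u x)) = (\<lambda>x. 0 + (-1) * (deriv u x * sin (u x)))"
    by (rule ext, rule DERIV_imp_deriv) (auto intro!: derivative_eq_intros u')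
  then have X': "fps_deriv (X x) $ k = - ((fps_deriv (U x) * Y x) $ k)" for x k
    using smooth_line_affine_out(2)[OF smooth_line_mult(1)[OF smooth_line_deriv(1)[OF u] cs(2)],
        of k 0 "-1" x]
    unfolding X_def Y_def U_def smooth_line_deriv(2)[OF cs(1), symmetric]
      smooth_line_deriv(2)[OF u, symmetric]
      smooth_line_mult(2)[OF smooth_line_deriv(1)[OF u] cs(2), symmetric]
    by (cases "k = 0") auto
  have "deriv (\<lambda>x. sin (u x)) = (\<lambda>x. deriv u x * cos (u x))"
    by (rule ext, rule DERIV_imp_deriv) (auto intro!: derivative_eq_intros u')
  then have Y': "fps_deriv (Y x) $ k = (fps_deriv (U x) * X x) $ k" for x k
    unfolding X_def Y_def U_def smooth_line_deriv(2)[OF cs(2), symmetric]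
      smooth_line_deriv(2)[OF u, symmetric]
      smooth_line_mult(2)[OF smooth_line_deriv(1)[OF u] cs(1), symmetric]
    by simp
  have conv: "\<bar>(fps_deriv (U x) * Z) $ k\<bar> \<le> real (Suc k) * (q ^ Suc k * N (Suc k))"
    if Z: "\<And>i. i \<le> k \<Longrightarrow> \<bar>Z $ i\<bar> \<le> q ^ i * N i" for Z x k
  proof -
    have "\<bar>(fps_deriv (U x) * Z) $ k\<bar> \<le> (\<Sum>i=0..k. \<bar>fps_deriv (U x) $ i\<bar> * \<bar>Z $ (k - i)\<bar>)"
      unfolding fps_mult_nth abs_mult[symmetric] by (rule sum_abs)
    also have "\<dots> \<le> (\<Sum>i=0..k. real (Suc k) * N (Suc k) * (a * b * (b ^ i * q ^ (k - i))))"
    proof (rule sum_mono)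
      fix i assume i: "i \<in> {0..k}"
      have "\<bar>fps_deriv (U x) $ i\<bar> * \<bar>Z $ (k - i)\<bar>
          \<le> (real (Suc k) * (a * b ^ Suc i * N (Suc i))) * (q ^ (k - i) * N (k - i))"
      proof (rule mult_mono)
        have "\<bar>fps_deriv (U x) $ i\<bar> = real (Suc i) * \<bar>U x $ Suc i\<bar>"
          by (simp add: abs_mult)
        also have "\<dots> \<le> real (Suc k) * (a * b ^ Suc i * N (Suc i))"
          using bd[of "Suc i" x] i unfolding U_def by (intro mult_mono) auto
        finally show "\<bar>fps_deriv (U x) $ i\<bar> \<le> real (Suc k) * (a * b ^ Suc i * N (Suc i))" .
      qed (use Z i N ab q in auto)
      also have "\<dots> = real (Suc k) * (a * b * (b ^ i * q ^ (k - i))) * (N (Suc i) * N (k - i))"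
        by simp
      also have "\<dots> \<le> real (Suc k) * (a * b * (b ^ i * q ^ (k - i))) * N (Suc k)"
        using N(3)[of "Suc i" "k - i"] i ab q by (intro mult_left_mono) auto
      finally show "\<bar>fps_deriv (U x) $ i\<bar> * \<bar>Z $ (k - i)\<bar>
          \<le> real (Suc k) * N (Suc k) * (a * b * (b ^ i * q ^ (k - i)))"
        by (simp add: mult_ac)
    qed
    also have "\<dots> = real (Suc k) * N (Suc k) * ((q - b) * (\<Sum>i<Suc k. b ^ i * q ^ (k - i)))"
    proof -
      have "a * b = q - b" by (simp add: q_def algebra_simps)
      then show ?thesis
        by (simp only: sum_distrib_left[symmetric] atLeast0AtMost lessThan_Suc_atMost)
    qed
    also have "(q - b) * (\<Sum>i<Suc k. b ^ i * q ^ (k - i)) = q ^ Suc k - b ^ Suc k"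
      using diff_power_eq_sum[of b k q] by (simp add: algebra_simps)
    also have "real (Suc k) * N (Suc k) * (q ^ Suc k - b ^ Suc k)
        \<le> real (Suc k) * N (Suc k) * q ^ Suc k"
      using ab N(1) by (intro mult_left_mono) auto
    finally show ?thesis by (simp add: mult_ac)
  qed
  have main: "\<bar>X x $ k\<bar> \<le> q ^ k * N k \<and> \<bar>Y x $ k\<bar> \<le> q ^ k * N k" for k x
  proof (induction k rule: less_induct)
    case (less k)
    show ?case
    proof (cases k)
      case 0
      then show ?thesis by (simp add: X_def Y_def N)
    next
      case (Suc m)
      have "\<bar>fps_deriv (X x) $ m\<bar> \<le> real (Suc m) * (q ^ Suc m * N (Suc m))"
        unfolding X' abs_minus_cancel using less Suc by (intro conv) auto
      moreover have "\<bar>fps_deriv (Y x) $ m\<bar> \<le> real (Suc m) * (q ^ Suc m * N (Suc m))"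
        unfolding Y' using less Suc by (intro conv) auto
      ultimately have "real (Suc m) * \<bar>X x $ Suc m\<bar> \<le> real (Suc m) * (q ^ Suc m * N (Suc m))"
        "real (Suc m) * \<bar>Y x $ Suc m\<bar> \<le> real (Suc m) * (q ^ Suc m * N (Suc m))"
        by (simp_all add: abs_mult)
      then show ?thesis
        unfolding Suc by (metis mult_le_cancel_left_pos of_nat_0_less_iff zero_less_Suc)
    qed
  qed
  show "taylor_bounded N ((1 + a) * b) (\<lambda>x. cos (u x))"
    and "taylor_bounded N ((1 + a) * b) (\<lambda>x. sin (u x))"
    using main unfolding taylor_bounded_def X_def Y_def q_def by blast+
qed

unbundle no fps_syntax
unbundle vec_syntax

section \<open>A step function as an infinite convolution\<close>

text \<open>
  The convolution of \<open>f\<close> with the normalised indicator of \<open>[0,w]\<close>, rescaled to the unit interval so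
  that pointwise estimates of \<open>f\<close> pass to the average without dividing by \<open>w\<close>.
\<close>

definition box_avg :: "real \<Rightarrow> (real \<Rightarrow> real) \<Rightarrow> real \<Rightarrow> real" where
  "box_avg w f x = integral {0..1} (\<lambda>s. f (x - w * s))"

lemma box_avg_integrable:
  fixes f :: "real \<Rightarrow> real"
  assumes "continuous_on UNIV f"
  shows "(\<lambda>s. f (x - w * s)) integrable_on {0..1::real}"
  by (rule integrable_continuous_interval, rule continuous_on_compose2[OF assms])
    (auto intro!: continuous_intros)

lemma box_avg_le:
  assumes "continuous_on UNIV f" "continuous_on UNIV g"
    and "\<And>s. 0 \<le> s \<Longrightarrow> s \<le> 1 \<Longrightarrow> f (x - w * s) \<le> g (y - w * s) + c"
  shows "box_avg w f x \<le> box_avg w g y + c"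
proof -
  have "box_avg w f x \<le> integral {0..1} (\<lambda>s. g (y - w * s) + c)"
    unfolding box_avg_def using assms
    by (intro integral_le box_avg_integrable integrable_add integrable_const_ivl) auto
  also have "\<dots> = box_avg w g y + c"
    unfolding box_avg_def using box_avg_integrable[OF assms(2)] by (subst integral_add) auto
  finally show ?thesis .
qed

lemma box_avg_const: "box_avg w (\<lambda>_. c) x = c"
  by (simp add: box_avg_def)

lemma box_avg_cong:
  "(\<And>s. 0 \<le> s \<Longrightarrow> s \<le> 1 \<Longrightarrow> f (x - w * s) = g (x - w * s)) \<Longrightarrow> box_avg w f x = box_avg w g x"
  unfolding box_avg_def by (rule integral_cong) auto

text \<open>
  This is where smoothness is gained: the derivative of an average of \<open>f\<close> is a difference quotient
  of \<open>f\<close> itself, so one derivative costs a factor \<open>2 / w\<close>.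
\<close>

lemma box_avg_has_derivative:
  assumes f: "continuous_on UNIV f" and w: "w > 0"
  shows "(box_avg w f has_real_derivative (f x - f (x - w)) / w) (at x)"
proof -
  obtain P where "\<And>y. y \<in> {x - w - 1..x + 1} \<Longrightarrow>
      (P has_vector_derivative f y) (at y within {x - w - 1..x + 1})"
    using antiderivative_continuous[of "x - w - 1" "x + 1" f] continuous_on_subset[OF f] by blast
  note P_within = this
  have P: "(P has_real_derivative f y) (at y)" if "y \<in> {x - w - 1<..<x + 1}" for y
  proof -
    have "at y within {x - w - 1..x + 1} = at y"
      using that by (intro at_within_interior) auto
    moreover have "y \<in> {x - w - 1..x + 1}" using that by auto
    ultimately show ?thesis
      using P_within unfolding has_real_derivative_iff_has_vector_derivative by metis
  qed
  have eq: "(P y - P (y - w)) / w = box_avg w f y" if y: "y \<in> {x - 1<..<x + 1}" for y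
  proof -
    have "((\<lambda>s. f (y - w * s)) has_integral (- P (y - w * 1) / w) - (- P (y - w * 0) / w)) {0..1}"
    proof (rule fundamental_theorem_of_calculus)
      fix s :: real assume s: "s \<in> {0..1}"
      have "w * s \<le> w * 1" "0 \<le> w * s" using s w by (auto intro!: mult_left_mono simp del: mult_1_right)
      then have "y - w * s \<in> {x - w - 1<..<x + 1}" using y by auto
      note P[OF this]
      moreover have "((\<lambda>s. y - w * s) has_real_derivative - w) (at s)"
        by (auto intro!: derivative_eq_intros)
      ultimately have "((\<lambda>s. P (y - w * s)) has_real_derivative f (y - w * s) * - w) (at s)"
        by (rule DERIV_chain2)
      from DERIV_cdivide[OF DERIV_minus[OF this], of w]
      show "((\<lambda>s. - P (y - w * s) / w) has_vector_derivative f (y - w * s)) (at s within {0..1})"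
        using w by (auto simp: has_real_derivative_iff_has_vector_derivative
            intro: has_vector_derivative_at_within)
    qed simp
    then show ?thesis
      unfolding box_avg_def by (subst integral_unique) (auto simp: diff_divide_distrib)
  qed
  have "((\<lambda>y. (P y - P (y - w)) / w) has_real_derivative (f x - f (x - w)) / w) (at x)"
  proof (intro DERIV_cdivide DERIV_diff P)
    have "((\<lambda>y. y - w) has_real_derivative 1) (at x)"
      by (auto intro!: derivative_eq_intros)
    from DERIV_chain2[OF P this] show "((\<lambda>y. P (y - w)) has_real_derivative f (x - w)) (at x)"
      using w by simp
  qed (use w in auto)
  then show ?thesis
    by (rule has_field_derivative_transform_within_open[where S = "{x - 1<..<x + 1}"]) (auto simp: eq)
qed

definition ramp :: "real \<Rightarrow> real" where
  "ramp x = max 0 (min 1 (2 * x))"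

text \<open>
  The ramp averaged over the lengths \<open>w m, \<dots>, w (m + n - 1)\<close>. The start index \<open>m\<close> is kept because
  the derivative of the limit from \<open>m\<close> on is a difference quotient of the limit from \<open>m + 1\<close> on.
\<close>

primrec ramp_avg :: "(nat \<Rightarrow> real) \<Rightarrow> nat \<Rightarrow> nat \<Rightarrow> real \<Rightarrow> real" where
  "ramp_avg w 0 m = ramp"
| "ramp_avg w (Suc n) m = box_avg (w m) (ramp_avg w n (Suc m))"

lemma continuous_on_of_lipschitz:
  fixes f :: "real \<Rightarrow> real"
  assumes "\<And>x y. f x \<le> f y + 2 * \<bar>x - y\<bar>"
  shows "continuous_on UNIV f"
proof -
  have "2-lipschitz_on UNIV f"
  proof (rule lipschitz_onI)
    fix x y :: real
    show "dist (f x) (f y) \<le> 2 * dist x y"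
      using assms[of x y] assms[of y x] by (auto simp: dist_real_def abs_if split: if_splits)
  qed simp
  then show ?thesis by (rule lipschitz_on_continuous_on)
qed

lemma ramp_avg_lipschitz: "ramp_avg w n m x \<le> ramp_avg w n m y + 2 * \<bar>x - y\<bar>"
proof (induction n arbitrary: m x y)
  case 0
  then show ?case by (auto simp: ramp_def max_def min_def abs_if)
next
  case (Suc n)
  have "continuous_on UNIV (ramp_avg w n (Suc m))"
    by (rule continuous_on_of_lipschitz) (rule Suc)
  moreover have "ramp_avg w n (Suc m) (x - w m * s)
      \<le> ramp_avg w n (Suc m) (y - w m * s) + 2 * \<bar>x - y\<bar>" for s
    using Suc[of "Suc m" "x - w m * s" "y - w m * s"] by simp
  ultimately show ?case by (simp add: box_avg_le)
qed

lemma ramp_avg_continuous: "continuous_on UNIV (ramp_avg w n m)"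
  by (rule continuous_on_of_lipschitz) (rule ramp_avg_lipschitz)

lemma ramp_avg_bounds: "0 \<le> ramp_avg w n m x \<and> ramp_avg w n m x \<le> 1"
proof (induction n arbitrary: m x)
  case 0
  then show ?case by (simp add: ramp_def)
next
  case (Suc n)
  have "box_avg (w m) (\<lambda>_. 0) x \<le> ramp_avg w (Suc n) m x + 0"
    unfolding ramp_avg.simps using Suc by (intro box_avg_le ramp_avg_continuous) auto
  moreover have "ramp_avg w (Suc n) m x \<le> box_avg (w m) (\<lambda>_. 1) x + 0"
    unfolding ramp_avg.simps using Suc by (intro box_avg_le ramp_avg_continuous) auto
  ultimately show ?case unfolding box_avg_const by simp
qed

lemma ramp_avg_eq_0:
  assumes "\<And>j. 0 \<le> w j" "x \<le> 0"
  shows "ramp_avg w n m x = 0"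
  using assms(2)
proof (induction n arbitrary: m x)
  case 0
  then show ?case by (simp add: ramp_def)
next
  case (Suc n)
  have "x - w m * s \<le> 0" if "0 \<le> s" for s
    using Suc.prems assms(1)[of m] that by (meson diff_le_0_iff_le mult_nonneg_nonneg order_trans)
  then have "box_avg (w m) (ramp_avg w n (Suc m)) x = box_avg (w m) (\<lambda>_. 0) x"
    by (intro box_avg_cong Suc.IH) auto
  then show ?case by (simp add: box_avg_const)
qed

lemma ramp_avg_eq_1:
  assumes "\<And>j. 0 \<le> w j" "1 / 2 + (\<Sum>i<n. w (m + i)) \<le> x"
  shows "ramp_avg w n m x = 1"
  using assms(2)
proof (induction n arbitrary: m x)
  case 0
  then show ?case by (simp add: ramp_def)
next
  case (Suc n)
  have "1 / 2 + (\<Sum>i<n. w (Suc m + i)) \<le> x - w m * s" if "s \<le> 1" for s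
  proof -
    have "w m * s \<le> w m" using assms(1)[of m] that mult_left_mono[of s 1 "w m"] by simp
    moreover have "(\<Sum>i<Suc n. w (m + i)) = w m + (\<Sum>i<n. w (Suc m + i))"
      by (subst sum.lessThan_Suc_shift) simp
    ultimately show ?thesis using Suc.prems by linarith
  qed
  then have "box_avg (w m) (ramp_avg w n (Suc m)) x = box_avg (w m) (\<lambda>_. 1) x"
    by (intro box_avg_cong Suc.IH) auto
  then show ?case by (simp add: box_avg_const)
qed

text \<open>
  The additional average acts innermost, on the ramp, which has Lipschitz constant 2; the outer
  averages do not increase the distance.
\<close>

lemma ramp_avg_step:
  assumes "\<And>j. 0 \<le> w j"
  shows "\<bar>ramp_avg w (Suc n) m x - ramp_avg w n m x\<bar> \<le> 2 * w (m + n)"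
proof (induction n arbitrary: m x)
  case 0
  have r: "continuous_on UNIV ramp" using ramp_avg_continuous[of w 0 m] by simp
  have *: "\<bar>ramp (x - w m * s) - ramp x\<bar> \<le> 2 * w m" if "0 \<le> s" "s \<le> 1" for s
  proof -
    have "w m * s \<le> w m" "0 \<le> w m * s"
      using assms[of m] that mult_left_mono[of s 1 "w m"] by simp_all
    then show ?thesis by (simp add: ramp_def max_def min_def abs_le_iff)
  qed
  have "box_avg (w m) ramp x \<le> box_avg (w m) (\<lambda>_. ramp x) x + 2 * w m"
    using * by (intro box_avg_le r) (force simp: abs_le_iff algebra_simps)+
  moreover have "box_avg (w m) (\<lambda>_. ramp x) x \<le> box_avg (w m) ramp x + 2 * w m"
    using * by (intro box_avg_le r) (force simp: abs_le_iff algebra_simps)+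
  ultimately show ?case by (simp add: box_avg_const abs_le_iff)
next
  case (Suc n)
  let ?f = "ramp_avg w (Suc n) (Suc m)" and ?g = "ramp_avg w n (Suc m)"
  have "\<bar>?f y - ?g y\<bar> \<le> 2 * w (m + Suc n)" for y
    using Suc.IH[of "Suc m" y] by simp
  then have *: "?f y \<le> ?g y + 2 * w (m + Suc n)" "?g y \<le> ?f y + 2 * w (m + Suc n)" for y
    by (smt (verit))+
  have "box_avg (w m) ?f x \<le> box_avg (w m) ?g x + 2 * w (m + Suc n)"
    by (intro box_avg_le ramp_avg_continuous *)
  moreover have "box_avg (w m) ?g x \<le> box_avg (w m) ?f x + 2 * w (m + Suc n)"
    by (intro box_avg_le ramp_avg_continuous *)
  ultimately show ?case
    unfolding ramp_avg.simps(2)[of w "Suc n" m] ramp_avg.simps(2)[of w n m] by linarith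
qed

text \<open>
  The limits of \<open>ramp_avg w n m\<close> as \<open>n\<close> grows. They exist since the differences of successive terms are
  at most \<open>2 w (m + n)\<close>, and dominated convergence carries the recursion in \<open>m\<close> to the limit. The
  ramp rises over a length of \<open>1/2\<close> and the averages add at most \<open>1/2\<close>.
\<close>

lemma box_step_tower:
  assumes w: "\<And>j. 0 < w j" and sum_w: "\<And>n. (\<Sum>i<n. w i) \<le> 1 / 2"
  obtains F :: "nat \<Rightarrow> real \<Rightarrow> real" where
    "\<And>m x. ((F m) has_real_derivative (F (Suc m) x - F (Suc m) (x - w m)) / w m) (at x)"
    "\<And>m x. 0 \<le> F m x \<and> F m x \<le> 1"
    "\<And>m x. x \<le> 0 \<Longrightarrow> F m x = 0"
    "\<And>x. 1 \<le> x \<Longrightarrow> F 0 x = 1"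
proof -
  have w0: "0 \<le> w j" for j using w[of j] by simp
  define F where "F m x = lim (\<lambda>n. ramp_avg w n m x)" for m x
  have "summable w"
    using w0 sum_w unfolding lessThan_Suc_atMost[symmetric]
    by (intro bounded_imp_summable[where B = "1/2"]) (simp_all only: lessThan_Suc_atMost[symmetric])
  then have "summable (\<lambda>n. 2 * w (m + n))" for m
    by (intro summable_mult) (simp add: add.commute summable_iff_shift)
  then have "summable (\<lambda>n. ramp_avg w (Suc n) m x - ramp_avg w n m x)" for m x
    by (rule summable_comparison_test') (use ramp_avg_step[OF w0] in simp)
  moreover have "(\<Sum>i<n. ramp_avg w (Suc i) m x - ramp_avg w i m x)
      = ramp_avg w n m x - ramp_avg w 0 m x" for n m x
    by (rule sum_lessThan_telescope)
  ultimately have "convergent (\<lambda>n. ramp_avg w n m x - ramp_avg w 0 m x)" for m x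
    unfolding summable_iff_convergent by simp
  then have "convergent (\<lambda>n. (ramp_avg w n m x - ramp_avg w 0 m x) + ramp_avg w 0 m x)" for m x
    by (rule convergent_add[OF _ convergent_const])
  then have lim: "(\<lambda>n. ramp_avg w n m x) \<longlonglongrightarrow> F m x" for m x
    unfolding F_def by (simp add: convergent_LIMSEQ_iff)
  have lipschitz: "F m x \<le> F m y + 2 * \<bar>x - y\<bar>" for m x y
    by (rule LIMSEQ_le[OF lim tendsto_add[OF lim tendsto_const]])
      (use ramp_avg_lipschitz in blast)
  have cont: "continuous_on UNIV (F m)" for m
    by (rule continuous_on_of_lipschitz) (rule lipschitz)
  have "F m x = box_avg (w m) (F (Suc m)) x" for m x
  proof (rule LIMSEQ_unique)
    show "(\<lambda>n. ramp_avg w (Suc n) m x) \<longlonglongrightarrow> F m x"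
      by (rule LIMSEQ_Suc[OF lim])
    show "(\<lambda>n. ramp_avg w (Suc n) m x) \<longlonglongrightarrow> box_avg (w m) (F (Suc m)) x"
      unfolding ramp_avg.simps box_avg_def
    proof (rule dominated_convergence(2)[where h = "\<lambda>_. 1"])
      show "(\<lambda>s. ramp_avg w n (Suc m) (x - w m * s)) integrable_on {0..1}" for n
        by (rule box_avg_integrable) (rule ramp_avg_continuous)
      show "norm (ramp_avg w n (Suc m) (x - w m * s)) \<le> 1" for n s
        using ramp_avg_bounds[of w n "Suc m" "x - w m * s"] by simp
    qed (auto intro: lim)
  qed
  then have F_rec: "F m = box_avg (w m) (F (Suc m))" for m by blast
  show thesis
  proof (rule that)
    show "((F m) has_real_derivative (F (Suc m) x - F (Suc m) (x - w m)) / w m) (at x)" for m x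
      by (subst F_rec) (rule box_avg_has_derivative[OF cont w])
    show "0 \<le> F m x \<and> F m x \<le> 1" for m x
      using ramp_avg_bounds[of w _ m x]
      by (intro conjI LIMSEQ_le_const[OF lim] LIMSEQ_le_const2[OF lim]) auto
    show "F m x = 0" if "x \<le> 0" for m x
      using lim[of m x] LIMSEQ_unique that by (simp add: ramp_avg_eq_0[OF w0] LIMSEQ_const_iff)
    show "F 0 x = 1" if "1 \<le> x" for x
    proof -
      have "ramp_avg w n 0 x = 1" for n
        using sum_w[of n] that by (intro ramp_avg_eq_1 w0) auto
      then show ?thesis using lim[of 0 x] by (simp add: LIMSEQ_const_iff)
    qed
  qed
qed

text \<open>
  Iterating the relation of \<open>box_step_tower\<close>, the \<open>k\<close>-th derivative of \<open>F 0\<close> is a \<open>k\<close>-fold difference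
  quotient of \<open>F k\<close> with steps \<open>w 0, \<dots>, w (k - 1)\<close>, and \<open>F k\<close> takes values in \<open>[0,1]\<close>.
\<close>

lemma smooth_box_step:
  assumes w: "\<And>j. 0 < w j" and sum_w: "\<And>n. (\<Sum>i<n. w i) \<le> 1 / 2"
  obtains f :: "real \<Rightarrow> real" where
    "smooth_line f" "\<And>x. 0 \<le> f x \<and> f x \<le> 1"
    "\<And>x. x \<le> 0 \<Longrightarrow> f x = 0" "\<And>x. 1 \<le> x \<Longrightarrow> f x = 1"
    "\<And>k x. \<bar>(deriv ^^ k) f x\<bar> \<le> (\<Prod>i<k. 2 / w i)"
proof -
  obtain F :: "nat \<Rightarrow> real \<Rightarrow> real" where
    F': "\<And>m x. ((F m) has_real_derivative (F (Suc m) x - F (Suc m) (x - w m)) / w m) (at x)" and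
    F01: "\<And>m x. 0 \<le> F m x \<and> F m x \<le> 1" and
    F0: "\<And>m x. x \<le> 0 \<Longrightarrow> F m x = 0" and
    F1: "\<And>x. 1 \<le> x \<Longrightarrow> F 0 x = 1"
    using box_step_tower[OF assms] by blast
  \<comment> \<open>\<open>D k m\<close> is the \<open>k\<close>-th derivative of \<open>F m\<close>.\<close>
  define D where "D = rec_nat F (\<lambda>_ G m x. (G (Suc m) x - G (Suc m) (x - w m)) / w m)"
  have D_0: "D 0 = F"
    and D_Suc: "D (Suc k) m = (\<lambda>x. (D k (Suc m) x - D k (Suc m) (x - w m)) / w m)" for k m
    by (simp_all add: D_def)
  have D': "(D k m has_real_derivative D (Suc k) m x) (at x)" for k m x
  proof (induction k arbitrary: m x)
    case 0
    show ?case using F' by (simp add: D_0 D_Suc)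
  next
    case (Suc k)
    have "((\<lambda>x. x - w m) has_real_derivative 1) (at x)"
      by (auto intro!: derivative_eq_intros)
    from DERIV_chain2[OF Suc this]
    have "((\<lambda>x. D k (Suc m) (x - w m)) has_real_derivative D (Suc k) (Suc m) (x - w m)) (at x)"
      by simp
    then show ?case
      unfolding D_Suc[of "Suc k" m] by (subst D_Suc) (intro DERIV_cdivide DERIV_diff Suc)
  qed
  have bound: "\<bar>D k m x\<bar> \<le> (\<Prod>i<k. 2 / w (m + i))" for k m x
  proof (induction k arbitrary: m x)
    case 0
    show ?case using F01[of m x] by (simp add: D_0)
  next
    case (Suc k)
    let ?B = "\<Prod>i<k. 2 / w (Suc m + i)"
    have "\<bar>D k (Suc m) x - D k (Suc m) (x - w m)\<bar> \<le> 2 * ?B"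
      using Suc[of "Suc m" x] Suc[of "Suc m" "x - w m"] by linarith
    then have "\<bar>D (Suc k) m x\<bar> \<le> 2 * ?B / w m"
      using w[of m] by (simp add: D_Suc abs_divide divide_right_mono)
    also have "\<dots> = (\<Prod>i<Suc k. 2 / w (m + i))"
      by (subst prod.lessThan_Suc_shift) simp
    finally show ?case .
  qed
  note D0 = higher_deriv_eqI[of "\<lambda>k. D k 0", OF D']
  show thesis
  proof (rule that[of "F 0"])
    show "smooth_line (F 0)" using D0(2) by (simp add: D_0)
    show "\<bar>(deriv ^^ k) (F 0) x\<bar> \<le> (\<Prod>i<k. 2 / w i)" for k x
      using D0(1)[of k] bound[of k 0 x] by (simp add: D_0)
  qed (use F01 F0 F1 in auto)
qed

section \<open>A step adapted to the weight\<close>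

text \<open>
  For \<open>k = 0\<close> the argument of \<open>L\<close> is negative, but the power makes the value \<open>1\<close>.
\<close>

definition jet_weight :: "(real \<Rightarrow> real) \<Rightarrow> nat \<Rightarrow> real" where
  "jet_weight L k = L (real k - 1) ^ k"

lemma jet_weight_properties:
  assumes "\<And>t. 0 \<le> t \<Longrightarrow> 1 \<le> L t" "mono_on {0..} L"
  shows "jet_weight L 0 = 1" "0 \<le> jet_weight L k"
    and "jet_weight L i * jet_weight L j \<le> jet_weight L (i + j)"
proof -
  have L1: "1 \<le> L (real k - 1)" if "k > 0" for k
    using that by (intro assms(1)) auto
  show "jet_weight L 0 = 1" by (simp add: jet_weight_def)
  show "0 \<le> jet_weight L k"
    using L1[of k] by (cases "k = 0") (auto simp: jet_weight_def)
  show "jet_weight L i * jet_weight L j \<le> jet_weight L (i + j)"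
  proof (cases "i = 0 \<or> j = 0")
    case True
    then show ?thesis by (auto simp: jet_weight_def)
  next
    case False
    then have "L (real i - 1) \<le> L (real (i + j) - 1)" "L (real j - 1) \<le> L (real (i + j) - 1)"
      by (auto intro!: mono_onD[OF assms(2)])
    then show ?thesis
      using L1[of i] L1[of j] L1[of "i + j"] False unfolding jet_weight_def power_add
      by (intro mult_mono power_mono) auto
  qed
qed

text \<open>
  Comparison of the sum with the integral of a decreasing function; the term \<open>i = 0\<close> accounts for
  the summand \<open>1\<close> in \<open>M\<close>.
\<close>

lemma sum_box_widths_le:
  fixes L :: "real \<Rightarrow> real"
  assumes L_ge: "\<And>t. 0 \<le> t \<Longrightarrow> 1 \<le> L t" and L_mono: "mono_on {0..} L"
    and L_int: "(\<lambda>t. 1 / ((t + 1) * L t)) integrable_on {0..}"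
  shows "(\<Sum>i<n. 1 / ((real i + 1) * L (real i)))
           \<le> 1 + integral {0..} (\<lambda>t. 1 / ((t + 1) * L t))"
proof -
  let ?f = "\<lambda>t. 1 / ((t + 1) * L t)"
  have pos: "0 < (t + 1) * L t" if "0 \<le> t" for t
    using L_ge[OF that] that by (intro mult_pos_pos) auto
  have mono: "?f t \<le> ?f s" if "0 \<le> s" "s \<le> t" for s t
  proof -
    have "(s + 1) * L s \<le> (t + 1) * L t"
      using that L_ge[of s] mono_onD[OF L_mono, of s t] by (intro mult_mono) auto
    then show ?thesis using pos[of s] pos[of t] that by (intro divide_left_mono) auto
  qed
  have sub: "?f integrable_on {a..b}" if "0 \<le> a" for a b
    by (rule integrable_on_subinterval[OF L_int]) (use that in auto)
  have *: "(\<Sum>i<n. ?f (real (Suc i))) \<le> integral {0..real n} ?f" for n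
  proof (induction n)
    case (Suc n)
    have "?f (real (Suc n)) = integral {real n..real (Suc n)} (\<lambda>_. ?f (real (Suc n)))"
      by simp
    also have "\<dots> \<le> integral {real n..real (Suc n)} ?f"
      by (intro integral_le integrable_const_ivl sub mono) auto
    finally have "(\<Sum>i<Suc n. ?f (real (Suc i)))
        \<le> integral {0..real n} ?f + integral {real n..real (Suc n)} ?f"
      using Suc by simp
    also have "\<dots> = integral {0..real (Suc n)} ?f"
      by (intro Henstock_Kurzweil_Integration.integral_combine sub) auto
    finally show ?case .
  qed simp
  have nonneg: "0 \<le> ?f t" if "0 \<le> t" for t
    using pos[OF that] less_imp_le by simp
  have le: "integral {0..real n} ?f \<le> integral {0..} ?f" for n
    by (rule integral_subset_le[OF _ sub L_int]) (use nonneg in auto)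
  show ?thesis
  proof (cases n)
    case 0
    then show ?thesis using integral_nonneg[OF L_int] nonneg by simp
  next
    case (Suc m)
    have "?f 0 \<le> 1" using L_ge[of 0] by simp
    moreover have "(\<Sum>i<Suc m. ?f (real i)) = ?f 0 + (\<Sum>i<m. ?f (real (Suc i)))"
      by (subst sum.lessThan_Suc_shift) simp
    ultimately show ?thesis using *[of m] le[of m] unfolding Suc by linarith
  qed
qed

text \<open>
  The lengths \<open>w i\<close> add up to at most \<open>1/2\<close>, and their reciprocals multiply to
  \<open>(2 M)\<^sup>k k! L(0) \<cdots> L(k - 1)\<close>; the factorial is what the normalisation of the Taylor coefficients
  removes. The step that falls on \<open>[1,2]\<close> is the reflection of the one that rises on \<open>[0,1]\<close>.
\<close>

lemma jet_weight_step:
  fixes L :: "real \<Rightarrow> real"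
  assumes L_ge: "\<And>t. 0 \<le> t \<Longrightarrow> 1 \<le> L t" and L_mono: "mono_on {0..} L"
    and L_int: "(\<lambda>t. 1 / ((t + 1) * L t)) integrable_on {0..}"
    and M_def: "M = 1 + integral {0..} (\<lambda>t. 1 / ((t + 1) * L t))"
  obtains g where "smooth_line g" "\<And>x. 0 \<le> g x \<and> g x \<le> 1"
    "\<And>x. x \<le> 1 \<Longrightarrow> g x = 1" "\<And>x. 2 \<le> x \<Longrightarrow> g x = 0"
    "taylor_bounded (jet_weight L) (4 * M) g"
proof -
  define w where "w i = 1 / (2 * M) * (1 / ((real i + 1) * L (real i)))" for i
  have "0 \<le> 1 / ((t + 1) * L t)" if "0 \<le> t" for t
    using L_ge[OF that] that by simp
  then have M: "1 \<le> M"
    unfolding M_def using integral_nonneg[OF L_int] by simp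
  have L1: "1 \<le> L (real i)" for i by (rule L_ge) simp
  have w: "0 < w i" for i
    unfolding w_def using M L1[of i] by (intro mult_pos_pos divide_pos_pos) auto
  have sum_w: "(\<Sum>i<n. w i) \<le> 1 / 2" for n
  proof -
    have "(\<Sum>i<n. w i) = 1 / (2 * M) * (\<Sum>i<n. 1 / ((real i + 1) * L (real i)))"
      unfolding w_def sum_distrib_left ..
    also have "\<dots> \<le> 1 / (2 * M) * M"
      using sum_box_widths_le[OF L_ge L_mono L_int, of n] M unfolding M_def[symmetric]
      by (intro mult_left_mono) auto
    finally show ?thesis using M by simp
  qed
  obtain f :: "real \<Rightarrow> real" where f: "smooth_line f" "\<And>x. 0 \<le> f x \<and> f x \<le> 1"
    "\<And>x. x \<le> 0 \<Longrightarrow> f x = 0" "\<And>x. 1 \<le> x \<Longrightarrow> f x = 1" and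
    bound: "\<And>k x. \<bar>(deriv ^^ k) f x\<bar> \<le> (\<Prod>i<k. 2 / w i)"
    using smooth_box_step[OF w sum_w] by metis
  have prod: "(\<Prod>i<k. 2 / w i) \<le> fact k * ((4 * M) ^ k * jet_weight L k)" for k
  proof -
    have "(\<Prod>i<k. 2 / w i) \<le> (\<Prod>i<k. (4 * M * L (real k - 1)) * real (Suc i))"
    proof (rule prod_mono, safe)
      fix i assume i: "i < k"
      have "2 / w i = 4 * M * (real (Suc i) * L (real i))"
        using M L1[of i] by (simp add: w_def field_simps)
      also have "\<dots> \<le> 4 * M * (real (Suc i) * L (real k - 1))"
        using i M by (intro mult_left_mono mono_onD[OF L_mono]) auto
      finally show "2 / w i \<le> (4 * M * L (real k - 1)) * real (Suc i)" by (simp add: mult_ac)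
      show "0 \<le> 2 / w i" using w[of i] by simp
    qed
    also have "\<dots> = (4 * M * L (real k - 1)) ^ k * (\<Prod>i<k. real (Suc i))"
      by (subst prod.distrib) simp
    also have "(\<Prod>i<k. real (Suc i)) = fact k"
      by (induction k) (simp_all add: algebra_simps)
    finally show ?thesis by (simp add: jet_weight_def power_mult_distrib mult_ac)
  qed
  define g where "g x = f (2 + (-1) * x)" for x
  have "\<bar>(deriv ^^ k) g x / fact k\<bar> \<le> (4 * M) ^ k * jet_weight L k" for k x
  proof -
    have "\<bar>(deriv ^^ k) g x\<bar> \<le> fact k * ((4 * M) ^ k * jet_weight L k)"
      unfolding g_def smooth_line_affine_in(2)[OF f(1)] abs_mult power_abs
      using order_trans[OF bound prod] by simp
    then show ?thesis by (simp add: abs_divide divide_le_eq mult_ac)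
  qed
  then have "taylor_bounded (jet_weight L) (4 * M) g"
    unfolding taylor_bounded_def by simp
  then show thesis
    using f smooth_line_affine_in(1)[OF f(1), of 2 "-1"]
    by (intro that[of g]) (auto simp: g_def[abs_def])
qed

section \<open>Smooth functions on the orthant\<close>

lemma set_coord_nth [simp]: "set_coord j s t $ i = (if i = j then s else t $ i)"
  by (simp add: set_coord_def)

lemma set_coord_same [simp]: "set_coord j (t $ j) t = t"
  by (simp add: vec_eq_iff)

lemma set_coord_twice [simp]: "set_coord j s (set_coord j s' t) = set_coord j s t"
  by (simp add: vec_eq_iff)

lemma set_coord_orthant: "t \<in> orthant \<Longrightarrow> 0 \<le> s \<Longrightarrow> set_coord j s t \<in> orthant"
  by (simp add: orthant_def)

text \<open>
  A class of functions on the whole space that contains the cutoffs and is closed under partial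
  differentiation. Membership therefore gives all mixed partial derivatives at once, without
  computing any of them.
\<close>

inductive smooth_expr :: "(real^'n \<Rightarrow> real) \<Rightarrow> bool" where
  coord: "smooth_line \<phi> \<Longrightarrow> smooth_expr (\<lambda>t. \<phi> (t $ i))"
| add: "smooth_expr f \<Longrightarrow> smooth_expr g \<Longrightarrow> smooth_expr (\<lambda>t. f t + g t)"
| mult: "smooth_expr f \<Longrightarrow> smooth_expr g \<Longrightarrow> smooth_expr (\<lambda>t. f t * g t)"
| cos: "smooth_expr f \<Longrightarrow> smooth_expr (\<lambda>t. cos (f t))"
| sin: "smooth_expr f \<Longrightarrow> smooth_expr (\<lambda>t. sin (f t))"

lemma smooth_line_const: "smooth_line (\<lambda>_. c)"
  using higher_deriv_eqI(2)[of "\<lambda>k _. if k = 0 then c else 0"] by simp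

lemma smooth_expr_const: "smooth_expr (\<lambda>_. c)"
  using smooth_expr.coord[OF smooth_line_const[of c]] .

lemma smooth_expr_prod:
  "finite I \<Longrightarrow> (\<And>i. i \<in> I \<Longrightarrow> smooth_expr (f i)) \<Longrightarrow> smooth_expr (\<lambda>t. \<Prod>i\<in>I. f i t)"
  by (induction I rule: finite_induct) (auto intro: smooth_expr_const smooth_expr.mult)

lemma smooth_expr_continuous: "smooth_expr f \<Longrightarrow> continuous_on UNIV f"
proof (induction rule: smooth_expr.induct)
  case (coord \<phi> i)
  have "continuous_on UNIV \<phi>"
    using smooth_line_deriv(3)[OF coord]
    by (intro continuous_at_imp_continuous_on ballI DERIV_isCont)
  then show ?case by (rule continuous_on_compose2) (auto intro: continuous_intros)
qed (auto intro: continuous_intros)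

lemma smooth_expr_partial:
  "smooth_expr f \<Longrightarrow> \<exists>f'. smooth_expr f' \<and>
    (\<forall>t s. ((\<lambda>s. f (set_coord j s t)) has_real_derivative f' (set_coord j s t)) (at s))"
proof (induction rule: smooth_expr.induct)
  case (coord \<phi> i)
  show ?case
  proof (cases "i = j")
    case True
    then show ?thesis
      using smooth_expr.coord[OF smooth_line_deriv(1)[OF coord], of i] smooth_line_deriv(3)[OF coord]
      by (intro exI[of _ "\<lambda>t. deriv \<phi> (t $ i)"]) auto
  next
    case False
    then show ?thesis
      by (intro exI[of _ "\<lambda>_. 0"]) (auto intro: smooth_expr_const)
  qed
next
  case (add f g)
  then obtain f' g' where "smooth_expr f'" "smooth_expr g'"
    "\<And>t s. ((\<lambda>s. f (set_coord j s t)) has_real_derivative f' (set_coord j s t)) (at s)"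
    "\<And>t s. ((\<lambda>s. g (set_coord j s t)) has_real_derivative g' (set_coord j s t)) (at s)"
    by blast
  then show ?case
    by (intro exI[of _ "\<lambda>t. f' t + g' t"]) (auto intro: smooth_expr.add DERIV_add)
next
  case (mult f g)
  then obtain f' g' where "smooth_expr f'" "smooth_expr g'"
    "\<And>t s. ((\<lambda>s. f (set_coord j s t)) has_real_derivative f' (set_coord j s t)) (at s)"
    "\<And>t s. ((\<lambda>s. g (set_coord j s t)) has_real_derivative g' (set_coord j s t)) (at s)"
    by blast
  with mult.hyps show ?case
    by (intro exI[of _ "\<lambda>t. f t * g' t + f' t * g t"])
      (auto intro!: smooth_expr.add smooth_expr.mult DERIV_mult')
next
  case (cos f)
  then obtain f' where "smooth_expr f'"
    "\<And>t s. ((\<lambda>s. f (set_coord j s t)) has_real_derivative f' (set_coord j s t)) (at s)"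
    by blast
  with cos.hyps show ?case
    by (intro exI[of _ "\<lambda>t. (-1) * (sin (f t) * f' t)"] conjI smooth_expr.sin smooth_expr.mult
          smooth_expr_const) (auto intro!: derivative_eq_intros)
next
  case (sin f)
  then obtain f' where "smooth_expr f'"
    "\<And>t s. ((\<lambda>s. f (set_coord j s t)) has_real_derivative f' (set_coord j s t)) (at s)"
    by blast
  with sin.hyps show ?case
    by (intro exI[of _ "\<lambda>t. cos (f t) * f' t"])
      (auto intro!: smooth_expr.cos smooth_expr.mult derivative_eq_intros)
qed

lemma smooth_line_set_coord:
  fixes f :: "real^'n \<Rightarrow> real"
  assumes "smooth_expr f"
  shows "smooth_line (\<lambda>s. f (set_coord j s t))"
proof -
  have "\<exists>f'. \<forall>f. smooth_expr f \<longrightarrow> smooth_expr (f' f) \<and>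
    (\<forall>t s. ((\<lambda>s. f (set_coord j s t)) has_real_derivative f' f (set_coord j s t)) (at s))"
    using smooth_expr_partial[of _ j] by (intro choice) blast
  then obtain f' :: "(real^'n \<Rightarrow> real) \<Rightarrow> real^'n \<Rightarrow> real" where
    f': "\<And>f. smooth_expr f \<Longrightarrow> smooth_expr (f' f)"
    "\<And>f t s. smooth_expr f \<Longrightarrow>
        ((\<lambda>s. f (set_coord j s t)) has_real_derivative f' f (set_coord j s t)) (at s)"
    by blast
  have sm: "smooth_expr ((f' ^^ k) f)" for k
    by (induction k) (auto intro: assms f')
  show ?thesis
    using higher_deriv_eqI(2)[of "\<lambda>k s. (f' ^^ k) f (set_coord j s t)"] f'(2)[OF sm] by simp
qed

lemma at_within_atLeast_neq_bot: "0 \<le> x \<Longrightarrow> at x within {0..} \<noteq> bot" for x :: real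
  using islimpt_subset[of x "{x..x + 1}" "{0..}"] by (simp add: trivial_limit_within)

text \<open>
  The values of \<open>f\<close> outside the orthant are unknown in applications, where \<open>f\<close> is itself an iterated
  one-sided derivative; hence \<open>f\<close> is only compared with a function \<open>\<phi>\<close> that is differentiable on both
  sides.
\<close>

lemma has_pderiv:
  assumes t: "t \<in> orthant"
    and f: "\<And>s. 0 \<le> s \<Longrightarrow> f (set_coord j s t) = \<phi> s"
    and \<phi>: "(\<phi> has_real_derivative D) (at (t $ j))"
  shows "pderiv_at j f t = D"
    and "(\<lambda>s. f (set_coord j s t)) differentiable (at (t $ j) within {0..})"
proof -
  have tj: "0 \<le> t $ j" using t by (simp add: orthant_def)
  have "(\<phi> has_vector_derivative D) (at (t $ j) within {0..})"
    using \<phi> by (auto simp: has_real_derivative_iff_has_vector_derivative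
        intro: has_vector_derivative_at_within)
  then have *: "((\<lambda>s. f (set_coord j s t)) has_vector_derivative D) (at (t $ j) within {0..})"
    by (rule has_vector_derivative_transform[rotated 2]) (use tj f in auto)
  show "pderiv_at j f t = D"
    unfolding pderiv_at_def
    by (rule vector_derivative_within[OF at_within_atLeast_neq_bot[OF tj] *])
  show "(\<lambda>s. f (set_coord j s t)) differentiable (at (t $ j) within {0..})"
    using * by (rule differentiableI_vector)
qed

text \<open>
  The statement is about \<open>g\<close> rather than \<open>f\<close> because a partial derivative agrees with a member of the
  class on the orthant only.
\<close>

lemma C_orthant_smooth_expr:
  assumes "smooth_expr f" and "\<And>t. t \<in> orthant \<Longrightarrow> g t = f t"
  shows "C_orthant m g"
  using assms
proof (induction m arbitrary: f g)
  case 0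
  then show ?case
    using continuous_on_subset[OF smooth_expr_continuous[OF 0(1)]]
    by (auto intro: iffD2[OF continuous_on_cong[OF refl]])
next
  case (Suc m)
  have "pdifferentiable j g \<and> C_orthant m (pderiv_at j g)" for j
  proof -
    obtain f' where f': "smooth_expr f'"
      "\<And>t s. ((\<lambda>s. f (set_coord j s t)) has_real_derivative f' (set_coord j s t)) (at s)"
      using smooth_expr_partial[OF Suc.prems(1), of j] by blast
    note * = has_pderiv[where f = g and \<phi> = "\<lambda>s. f (set_coord j s t)" and D = "f' t" for t]
    have "pderiv_at j g t = f' t" if "t \<in> orthant" for t
      using f'(2)[where t = t and s = "t $ j"] that Suc.prems(2) set_coord_orthant by (intro *) auto
    then have "C_orthant m (pderiv_at j g)"
      by (rule Suc.IH[OF f'(1)])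
    moreover have "pdifferentiable j g"
      unfolding pdifferentiable_def
    proof
      fix t :: "real^'a" assume "t \<in> orthant"
      then show "(\<lambda>s. g (set_coord j s t)) differentiable (at (t $ j) within {0..})"
        using f'(2)[where t = t and s = "t $ j"] Suc.prems(2) set_coord_orthant by (intro *) auto
    qed
    ultimately show ?thesis by blast
  qed
  moreover have "continuous_on orthant g"
    using Suc.prems continuous_on_subset[OF smooth_expr_continuous[OF Suc.prems(1)]]
    by (auto intro: iffD2[OF continuous_on_cong[OF refl]])
  ultimately show ?case by simp
qed

lemma smooth_orthant_smooth_expr: "smooth_expr f \<Longrightarrow> smooth_orthant f"
  unfolding smooth_orthant_def by (blast intro: C_orthant_smooth_expr)

lemma higher_pderiv_at:
  assumes f: "smooth_expr f" and t: "t \<in> orthant"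
  shows "(pderiv_at j ^^ k) f t = (deriv ^^ k) (\<lambda>s. f (set_coord j s t)) (t $ j)"
  using t
proof (induction k arbitrary: t)
  case (Suc k)
  have "pderiv_at j ((pderiv_at j ^^ k) f) t = (deriv ^^ Suc k) (\<lambda>s. f (set_coord j s t)) (t $ j)"
  proof (rule has_pderiv(1)[OF Suc.prems])
    show "((deriv ^^ k) (\<lambda>s. f (set_coord j s t)) has_real_derivative
        (deriv ^^ Suc k) (\<lambda>s. f (set_coord j s t)) (t $ j)) (at (t $ j))"
      by (rule smooth_lineD[OF smooth_line_set_coord[OF f]])
    show "(pderiv_at j ^^ k) f (set_coord j s t) = (deriv ^^ k) (\<lambda>s. f (set_coord j s t)) s"
      if "0 \<le> s" for s
      using Suc.IH[OF set_coord_orthant[OF Suc.prems that]] by simp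
  qed
  then show ?case by simp
qed simp

lemma S_class_smooth_expr:
  fixes A :: "real^'n \<Rightarrow> real"
  assumes A: "smooth_expr A" and \<gamma>: "1 \<le> \<gamma>" and q: "0 \<le> q" "q \<le> \<gamma>'"
    and L: "\<And>t. 0 \<le> t \<Longrightarrow> 1 \<le> L t"
    and A01: "\<And>t. t \<in> orthant \<Longrightarrow> \<bar>A t\<bar> \<le> 1"
    and bd: "\<And>j t. t \<in> orthant \<Longrightarrow> taylor_bounded (jet_weight L) q (\<lambda>s. A (set_coord j s t))"
  shows "A \<in> S_class L \<gamma> \<gamma>'"
proof -
  have "sup_norm A \<le> ereal \<gamma>"
    unfolding sup_norm_def using A01 \<gamma> by (intro SUP_least) (auto intro: order_trans)
  moreover have "ereal (1 / fact k) * sup_norm ((pderiv_at j ^^ k) A)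
      \<le> ereal (\<gamma> * (\<gamma>' * L (real k - 1)) ^ k)" if k: "1 \<le> k" for k j
  proof -
    have Lk: "1 \<le> L (real k - 1)" using k by (intro L) auto
    have "sup_norm ((pderiv_at j ^^ k) A) \<le> ereal (fact k * (\<gamma> * (\<gamma>' * L (real k - 1)) ^ k))"
      unfolding sup_norm_def
    proof (rule SUP_least)
      fix t :: "real^'n" assume t: "t \<in> orthant"
      have "\<bar>(pderiv_at j ^^ k) A t\<bar> \<le> fact k * (q ^ k * jet_weight L k)"
        using bd[OF t, of j] unfolding taylor_bounded_def higher_pderiv_at[OF A t] taylor_fps_nth
        by (simp add: abs_divide divide_le_eq mult_ac)
      also have "\<dots> \<le> fact k * (\<gamma> * (\<gamma>' * L (real k - 1)) ^ k)"
      proof (rule mult_left_mono)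
        have "q ^ k * jet_weight L k = 1 * (q * L (real k - 1)) ^ k"
          by (simp add: jet_weight_def power_mult_distrib)
        also have "\<dots> \<le> \<gamma> * (\<gamma>' * L (real k - 1)) ^ k"
          using q Lk \<gamma> by (intro mult_mono power_mono mult_right_mono) auto
        finally show "q ^ k * jet_weight L k \<le> \<gamma> * (\<gamma>' * L (real k - 1)) ^ k" .
      qed simp
      finally show "ereal \<bar>(pderiv_at j ^^ k) A t\<bar> \<le> ereal (fact k * (\<gamma> * (\<gamma>' * L (real k - 1)) ^ k))"
        by simp
    qed
    then have "ereal (1 / fact k) * sup_norm ((pderiv_at j ^^ k) A)
        \<le> ereal (1 / fact k) * ereal (fact k * (\<gamma> * (\<gamma>' * L (real k - 1)) ^ k))"
      by (rule ereal_mult_left_mono) simp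
    then show ?thesis by simp
  qed
  ultimately show ?thesis
    unfolding S_class_def using smooth_orthant_smooth_expr[OF A] by blast
qed

lemma infnorm_attained:
  fixes t :: "real^'n"
  assumes "t \<in> orthant"
  obtains m where "infnorm t = t $ m" "\<And>i. t $ i \<le> t $ m"
proof -
  have "finite (range (\<lambda>i. t $ i))" by simp
  then have "Max (range (\<lambda>i. t $ i)) \<in> range (\<lambda>i. t $ i)" by (rule Max_in) simp
  then obtain m where m: "Max (range (\<lambda>i. t $ i)) = t $ m" by blast
  then have le: "t $ i \<le> t $ m" for i
    unfolding m[symmetric] by (intro Max_ge) auto
  have "infnorm t = t $ m"
    unfolding infnorm_cart
    using assms le by (intro cSup_eq_maximum) (auto simp: orthant_def abs_of_nonneg intro!: exI[of _ m])
  then show thesis using le that by blast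
qed

section \<open>The cutoff functions\<close>

locale smooth_step =
  fixes g :: "real \<Rightarrow> real"
  assumes smooth: "smooth_line g"
    and bounds: "0 \<le> g x" "g x \<le> 1"
    and eq_1: "x \<le> 1 \<Longrightarrow> g x = 1"
    and eq_0: "2 \<le> x \<Longrightarrow> g x = 0"
begin

text \<open>
  The dilation by \<open>c\<close> is built in because type (c) combines the step at the scales \<open>1\<close> and \<open>2\<close>.
\<close>

definition cube_step :: "real \<Rightarrow> real^'n \<Rightarrow> real" where
  "cube_step c t = (\<Prod>i\<in>UNIV. g (c * t $ i))"

lemma cube_step_bounds: "0 \<le> cube_step c t" "cube_step c t \<le> 1"
  unfolding cube_step_def by (auto intro: prod_nonneg prod_le_1 bounds)

lemma cube_step_eq_1: "(\<And>i. c * t $ i \<le> 1) \<Longrightarrow> cube_step c t = 1"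
  unfolding cube_step_def by (simp add: eq_1)

lemma cube_step_eq_0: "2 \<le> c * t $ i \<Longrightarrow> cube_step c t = 0"
  unfolding cube_step_def by (auto intro!: bexI[of _ i] eq_0 simp: prod_zero_iff)

lemma cube_step_scale: "cube_step c (r *\<^sub>R t) = cube_step (c * r) t"
  by (simp add: cube_step_def mult.assoc)

lemma cube_step_smooth: "smooth_expr (cube_step c)"
  unfolding cube_step_def[abs_def]
  using smooth_line_affine_in(1)[OF smooth, of 0 c]
  by (intro smooth_expr_prod) (auto dest: smooth_expr.coord)

text \<open>
  If the largest coordinate is at least \<open>2 / c\<close>, both sides vanish; otherwise \<open>c * t $ k \<le> 1\<close>, where
  the factor of \<open>t $ k\<close> is \<open>1\<close>, as it is at \<open>0\<close>. The largest coordinate can be \<open>t $ k\<close> itself only if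
  \<open>t = 0\<close>.
\<close>

lemma cube_step_proj:
  fixes t :: "real^'n"
  assumes t: "t \<in> orthant" and k: "t $ k \<le> 1 / 2 * infnorm t" and c: "0 \<le> c"
  shows "cube_step c (proj k t) = cube_step c t"
proof -
  obtain m where m: "infnorm t = t $ m" "\<And>i. t $ i \<le> t $ m"
    using infnorm_attained[OF t] by blast
  have nonneg: "0 \<le> t $ i" for i using t by (simp add: orthant_def)
  show ?thesis
  proof (cases "m = k")
    case True
    then have "t $ k = 0" using k m nonneg[of k] by simp
    then have "proj k t = t" by (simp add: proj_def vec_eq_iff)
    then show ?thesis by simp
  next
    case False
    show ?thesis
    proof (cases "c * t $ m \<le> 2")
      case True
      have "c * t $ k \<le> c * (1 / 2 * t $ m)" using k m c by (intro mult_left_mono) auto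
      then have "g (c * t $ k) = 1" using True by (intro eq_1) simp
      then have "g (c * proj k t $ i) = g (c * t $ i)" for i
        by (simp add: proj_def eq_1)
      then show ?thesis unfolding cube_step_def by simp
    next
      case False
      then show ?thesis
        using \<open>m \<noteq> k\<close> cube_step_eq_0[of c t m] cube_step_eq_0[of c "proj k t" m]
        by (simp add: proj_def)
    qed
  qed
qed

text \<open>
  The restriction to a coordinate line reduces all bounds to those of the step itself, uniformly in
  the remaining coordinates.
\<close>

lemma cube_step_line:
  obtains p where "0 \<le> p" "p \<le> 1" "\<And>s. cube_step c (set_coord j s t) = p * g (c * s)"
proof -
  define p where "p = (\<Prod>i\<in>UNIV - {j}. g (c * t $ i))"
  show thesis
  proof (rule that[of p])
    show "0 \<le> p" "p \<le> 1" unfolding p_def by (auto intro: prod_nonneg prod_le_1 bounds)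
    show "cube_step c (set_coord j s t) = p * g (c * s)" for s
    proof -
      have "cube_step c (set_coord j s t)
          = g (c * s) * (\<Prod>i\<in>UNIV - {j}. g (c * set_coord j s t $ i))"
        unfolding cube_step_def by (subst prod.remove[of _ j]) auto
      also have "(\<Prod>i\<in>UNIV - {j}. g (c * set_coord j s t $ i)) = p"
        unfolding p_def by (intro prod.cong) auto
      finally show ?thesis by simp
    qed
  qed
qed

text \<open>
  The angle runs from \<open>0\<close>, where \<open>cube_step c\<close> is \<open>1\<close>, to \<open>\<pi>/2\<close>, where it vanishes, so that
  \<open>cos\<^sup>2\<close> of it is a step as well, and one whose complement to \<open>1\<close> is again the square of a smooth
  function.
\<close>

definition angle :: "real \<Rightarrow> real^'n \<Rightarrow> real" where
  "angle c t = pi / 2 + (- pi / 2) * cube_step c t"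

lemma angle_bounds: "0 \<le> angle c t" "angle c t \<le> pi / 2"
  using cube_step_bounds[of c t] mult_left_mono[of "cube_step c t" 1 "pi / 2"] by (auto simp: angle_def)

lemma angle_smooth: "smooth_expr (angle c)"
  unfolding angle_def[abs_def]
  by (intro smooth_expr.add smooth_expr.mult smooth_expr_const cube_step_smooth)

definition trig_cutoff :: "real^'n \<Rightarrow> real" where
  "trig_cutoff t = cos (angle 1 t) * sin (angle 2 t)"

lemma trig_cutoff_smooth: "smooth_expr trig_cutoff"
  unfolding trig_cutoff_def[abs_def]
  by (intro smooth_expr.mult smooth_expr.cos smooth_expr.sin angle_smooth)

lemma trig_cutoff_bounds: "0 \<le> trig_cutoff t" "trig_cutoff t \<le> 1"
proof -
  have "0 \<le> cos (angle 1 t)" "0 \<le> sin (angle 2 t)"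
    using angle_bounds[of 1 t] angle_bounds[of 2 t]
    by (auto intro!: cos_ge_zero sin_ge_zero)
  then show "0 \<le> trig_cutoff t" "trig_cutoff t \<le> 1"
    unfolding trig_cutoff_def by (auto intro: mult_le_one)
qed

text \<open>
  Where \<open>cos (angle 2 t)\<close> does not vanish, all coordinates of \<open>t\<close> are below \<open>1\<close>, and there
  \<open>cos (angle 1 t) = 1\<close>.
\<close>

lemma trig_cutoff_square:
  "(trig_cutoff t)\<^sup>2 = (cos (angle 1 t))\<^sup>2 - (cos (angle 2 t))\<^sup>2"
proof (cases "cos (angle 2 t) = 0")
  case True
  then have "(sin (angle 2 t))\<^sup>2 = 1" by (simp add: sin_squared_eq)
  then show ?thesis using True by (simp add: trig_cutoff_def power_mult_distrib)
next
  case False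
  have "1 * t $ i \<le> 1" for i
  proof (rule ccontr)
    assume "\<not> 1 * t $ i \<le> 1"
    then have "cube_step 2 t = 0" by (intro cube_step_eq_0[where i = i]) simp
    with False show False by (simp add: angle_def)
  qed
  then have "angle 1 t = 0" by (simp add: angle_def cube_step_eq_1)
  then show ?thesis by (simp add: trig_cutoff_def sin_squared_eq)
qed

text \<open>
  The squares telescope from the coarsest scale, where the coordinate \<open>t $ i \<ge> 1\<close> gives the value \<open>0\<close>,
  to fine scales, where \<open>t\<close> has shrunk into the unit cube and the value is \<open>1\<close>.
\<close>

lemma trig_cutoff_sums:
  assumes "1 \<le> t $ i"
  shows "(\<lambda>j. \<bar>trig_cutoff ((1 / 2 ^ j) *\<^sub>R t)\<bar>\<^sup>2) sums 1"
proof -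
  define f where "f n = (cos (angle (2 / 2 ^ n) t))\<^sup>2" for n :: nat
  have "eventually (\<lambda>n. f n = 1) sequentially"
  proof -
    have "(\<lambda>n. 2 * inverse ((2::real) ^ n) * t $ l) \<longlonglongrightarrow> 2 * 0 * t $ l" for l
      by (intro tendsto_intros LIMSEQ_inverse_realpow_zero) auto
    then have "\<forall>\<^sub>F n in sequentially. 2 * inverse ((2::real) ^ n) * t $ l < 1" for l
      by (rule order_tendstoD) simp
    then have "\<forall>\<^sub>F n in sequentially. \<forall>l. 2 * inverse ((2::real) ^ n) * t $ l < 1"
      by (simp add: eventually_all_finite)
    then show ?thesis
    proof eventually_elim
      case (elim n)
      then have "cube_step (2 / 2 ^ n) t = 1"
        by (intro cube_step_eq_1) (auto simp: divide_inverse intro: less_imp_le)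
      then show ?case by (simp add: f_def angle_def)
    qed
  qed
  then have "f \<longlonglongrightarrow> 1" by (rule tendsto_eventually)
  then have "(\<lambda>n. f (Suc n) - f n) sums (1 - f 0)" by (rule telescope_sums)
  moreover have "f 0 = 0"
    using assms cube_step_eq_0[of 2 t i] by (simp add: f_def angle_def)
  moreover have "f (Suc n) - f n = \<bar>trig_cutoff ((1 / 2 ^ n) *\<^sub>R t)\<bar>\<^sup>2" for n
    by (simp add: f_def trig_cutoff_square angle_def cube_step_scale)
  ultimately show ?thesis by simp
qed

lemma cutoff_second_kindI:
  fixes A :: "real^'n \<Rightarrow> real"
  assumes "smooth_expr A"
    and "\<And>t. cube_step 1 t = 0 \<Longrightarrow> A t = 0"
    and "\<And>t k. t \<in> orthant \<Longrightarrow> t $ k \<le> 1 / 2 * infnorm t \<Longrightarrow> A t = A (proj k t)"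
  shows "cutoff_second_kind A"
proof -
  have "support_on orthant A \<subseteq> {t. \<forall>i. 0 \<le> t $ i \<and> t $ i \<le> 2}"
  proof
    fix t assume "t \<in> support_on orthant A"
    then have t: "t \<in> orthant" "A t \<noteq> 0" by (auto simp: support_on_def)
    have "t $ i \<le> 2" for i
      using assms(2)[of t] cube_step_eq_0[of 1 t i] t(2) by fastforce
    with t(1) show "t \<in> {t. \<forall>i. 0 \<le> t $ i \<and> t $ i \<le> 2}" by (simp add: orthant_def)
  qed
  moreover have "closed {t :: real^'n. \<forall>i. 0 \<le> t $ i \<and> t $ i \<le> 2}"
    by (intro closed_Collect_all closed_Collect_conj closed_Collect_le continuous_intros)
  ultimately show ?thesis
    unfolding cutoff_second_kind_def
    using smooth_orthant_smooth_expr[OF assms(1)] assms(3) closure_minimal by blast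
qed

lemma B1_coord: "t \<in> B1 \<Longrightarrow> t $ i \<le> 1"
proof -
  assume t: "t \<in> B1"
  have "\<bar>t $ i\<bar> \<le> (\<Sum>i\<in>UNIV. \<bar>t $ i\<bar>)"
    by (rule member_le_sum) auto
  with t show ?thesis by (auto simp: B1_def l1_norm_def)
qed

lemma cutoff_a_cube_step: "cutoff_a (cube_step 1)"
  unfolding cutoff_a_def
  using cube_step_proj[where c = 1, symmetric] B1_coord
  by (intro conjI cutoff_second_kindI cube_step_smooth ballI cube_step_eq_1) auto

lemma cutoff_c_trig_cutoff: "cutoff_c trig_cutoff"
  unfolding cutoff_c_def cutoff_b_def
proof (intro conjI cutoff_second_kindI trig_cutoff_smooth ballI)
  show "trig_cutoff t = 0" if "cube_step 1 t = 0" for t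
    using that by (simp add: trig_cutoff_def angle_def)
  show "trig_cutoff t = trig_cutoff (proj k t)" if "t \<in> orthant" "t $ k \<le> 1 / 2 * infnorm t" for t k
    using that by (simp add: trig_cutoff_def angle_def cube_step_proj)
  show "trig_cutoff t = 0" if t: "t \<in> (\<lambda>t. (1 / 2) *\<^sub>R t) ` B1" for t
  proof -
    obtain s where s: "s \<in> B1" "t = (1 / 2) *\<^sub>R s" using t by blast
    have "cube_step 2 t = 1" using B1_coord[OF s(1)] by (intro cube_step_eq_1) (simp add: s(2))
    then show ?thesis by (simp add: trig_cutoff_def angle_def)
  qed
  show "(\<lambda>j. \<bar>trig_cutoff ((1 / 2 ^ j) *\<^sub>R t)\<bar>\<^sup>2) sums 1"
    if t: "t \<in> orthant - {t. \<forall>i. 0 \<le> t $ i \<and> t $ i < 1}" for t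
  proof -
    obtain i where "\<not> (0 \<le> t $ i \<and> t $ i < 1)" using t by blast
    then have "1 \<le> t $ i" using t by (auto simp: orthant_def)
    then show ?thesis by (rule trig_cutoff_sums)
  qed
qed

end

section \<open>Derivative bounds for the cutoff functions\<close>

lemma taylor_bounded_mono:
  assumes "taylor_bounded N q f" "0 \<le> q" "q \<le> q'" "\<And>k. 0 \<le> N k"
  shows "taylor_bounded N q' f"
  using assms unfolding taylor_bounded_def
  by (meson mult_right_mono order_trans power_mono)

locale bounded_smooth_step = smooth_step +
  fixes N :: "nat \<Rightarrow> real" and b :: real
  assumes N_nonneg: "0 \<le> N k" and N_0: "N 0 = 1" and N_mult: "N i * N j \<le> N (i + j)"
    and b_nonneg: "0 \<le> b"
    and step_bounded: "taylor_bounded N b g"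
begin

lemma scaled_step_bounded:
  assumes "0 \<le> c"
  shows "\<bar>(deriv ^^ k) (\<lambda>s. g (c * s)) x\<bar> / fact k \<le> (c * b) ^ k * N k"
proof -
  have "\<bar>(deriv ^^ k) (\<lambda>s. g (c * s)) x\<bar> / fact k = c ^ k * \<bar>fps_nth (taylor_fps g (c * x)) k\<bar>"
    using smooth_line_affine_in(2)[OF smooth, of k 0 c x] assms by (simp add: abs_mult)
  also have "\<dots> \<le> c ^ k * (b ^ k * N k)"
    using step_bounded assms unfolding taylor_bounded_def by (intro mult_left_mono) auto
  finally show ?thesis by (simp add: power_mult_distrib mult_ac)
qed

lemma smooth_scaled_step: "smooth_line (\<lambda>s. g (c * s))"
  using smooth_line_affine_in(1)[OF smooth, of 0 c] by simp

lemma cube_step_bounded: "taylor_bounded N b (\<lambda>s. cube_step 1 (set_coord j s t))"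
  unfolding taylor_bounded_def
proof (intro allI)
  fix k x
  obtain p where p: "0 \<le> p" "p \<le> 1" "\<And>s. cube_step 1 (set_coord j s t) = p * g (1 * s)"
    using cube_step_line by blast
  show "\<bar>fps_nth (taylor_fps (\<lambda>s. cube_step 1 (set_coord j s t)) x) k\<bar> \<le> b ^ k * N k"
  proof (cases "k = 0")
    case True
    then show ?thesis using cube_step_bounds[of 1 "set_coord j x t"] by (simp add: N_0)
  next
    case False
    then have "\<bar>fps_nth (taylor_fps (\<lambda>s. cube_step 1 (set_coord j s t)) x) k\<bar> = p * \<bar>fps_nth (taylor_fps g x) k\<bar>"
      using smooth_line_affine_out(2)[OF smooth, of k 0 p x] p(1)
      by (simp add: p(3) abs_mult)
    also have "\<dots> \<le> 1 * (b ^ k * N k)"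
      using p step_bounded unfolding taylor_bounded_def by (intro mult_mono) auto
    finally show ?thesis by simp
  qed
qed

lemma angle_bounded:
  assumes "0 \<le> c" "0 < k"
  shows "\<bar>fps_nth (taylor_fps (\<lambda>s. angle c (set_coord j s t)) x) k\<bar> \<le> 2 * (c * b) ^ k * N k"
proof -
  obtain p where p: "0 \<le> p" "p \<le> 1" "\<And>s. cube_step c (set_coord j s t) = p * g (c * s)"
    using cube_step_line by blast
  have "pi / 2 * p \<le> 2 * 1" using p pi_less_4 by (intro mult_mono) auto
  have "\<bar>fps_nth (taylor_fps (\<lambda>s. angle c (set_coord j s t)) x) k\<bar>
      = pi / 2 * p * (\<bar>(deriv ^^ k) (\<lambda>s. g (c * s)) x\<bar> / fact k)"
    using smooth_line_affine_out(2)[OF smooth_scaled_step, of k "pi / 2" "- pi / 2 * p" c x] assms p(1)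
    by (simp add: angle_def p(3) abs_mult mult.assoc)
  also have "\<dots> \<le> 2 * ((c * b) ^ k * N k)"
    using scaled_step_bounded[OF assms(1), of k x] \<open>pi / 2 * p \<le> 2 * 1\<close>
    by (intro mult_mono) auto
  finally show ?thesis by simp
qed

text \<open>
  The angle satisfies the bounds of \<open>angle_bounded\<close> with the factor \<open>2 \<ge> \<pi>/2\<close>, so cosine and sine have
  the constants \<open>3 b\<close> and \<open>3 (2 b)\<close>, and the product doubles the larger one.
\<close>

lemma trig_cutoff_bounded: "taylor_bounded N (12 * b) (\<lambda>s. trig_cutoff (set_coord j s t))"
proof -
  have sm: "smooth_line (\<lambda>s. cos (angle c (set_coord j s t)))"
    "smooth_line (\<lambda>s. sin (angle c (set_coord j s t)))"
    "smooth_line (\<lambda>s. angle c (set_coord j s t))" for c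
    by (intro smooth_line_set_coord smooth_expr.cos smooth_expr.sin angle_smooth)+
  note trig = taylor_bounded_cos_sin[OF N_nonneg N_0 N_mult _ _ sm(3) _ sm(1,2), of 2]
  have "taylor_bounded N ((1 + 2) * (1 * b)) (\<lambda>s. cos (angle 1 (set_coord j s t)))"
    using angle_bounded[of 1] b_nonneg by (intro trig(1)) auto
  then have "taylor_bounded N (6 * b) (\<lambda>s. cos (angle 1 (set_coord j s t)))"
    by (rule taylor_bounded_mono) (use b_nonneg N_nonneg in auto)
  moreover have "taylor_bounded N ((1 + 2) * (2 * b)) (\<lambda>s. sin (angle 2 (set_coord j s t)))"
    using angle_bounded[of 2] b_nonneg by (intro trig(2)) auto
  then have "taylor_bounded N (6 * b) (\<lambda>s. sin (angle 2 (set_coord j s t)))"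
    by simp
  ultimately show ?thesis
    using taylor_bounded_mult[OF N_nonneg N_mult _ sm(1) _ sm(2), of "6 * b"] b_nonneg
    unfolding trig_cutoff_def by simp
qed

end

theorem theorem3p10:
  fixes L :: "real \<Rightarrow> real" and M :: real and \<gamma>' :: real
  assumes L_ge: "\<And>t. 0 \<le> t \<Longrightarrow> 1 \<le> L t"
    and L_mono: "mono_on {0..} L"
    and L_0: "L 0 = 1"
    and L_int: "(\<lambda>t. 1 / ((t + 1) * L t)) integrable_on {0..}"
    and M_def: "M = 1 + integral {0..} (\<lambda>t. 1 / ((t + 1) * L t))"
    and L_convex: "convex_on {0..} (\<lambda>t. (t + 1) * ln (L t))"
    and \<gamma>'_def: "\<gamma>' = 10 * real CARD('n) * (2 * real CARD('n) - 1) * M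
                        * (8 * (real CARD('n) + 2) * M + 1)"
  shows "(\<exists>A :: real^'n \<Rightarrow> real. A \<in> S_class L 8 \<gamma>' \<and> cutoff_a A \<and>
            (\<forall>t\<in>orthant. 0 \<le> A t \<and> A t \<le> 1)) \<and>
         (\<exists>A :: real^'n \<Rightarrow> real. A \<in> S_class L 8 \<gamma>' \<and> cutoff_b A \<and>
            (\<forall>t\<in>orthant. 0 \<le> A t \<and> A t \<le> 1)) \<and>
         (\<exists>A :: real^'n \<Rightarrow> real. A \<in> S_class L 8 \<gamma>' \<and> cutoff_c A \<and>
            (\<forall>t\<in>orthant. 0 \<le> A t \<and> A t \<le> 1))"
proof -
  have "0 \<le> 1 / ((t + 1) * L t)" if "0 \<le> t" for t
    using L_ge[OF that] that by simp
  then have M: "1 \<le> M"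
    unfolding M_def using integral_nonneg[OF L_int] by simp
  have d: "1 \<le> real CARD('n)"
    using zero_less_card_finite[where 'a = 'n] by linarith
  then have d': "1 \<le> 2 * real CARD('n) - 1" by linarith
  \<comment> \<open>The factors of \<open>\<gamma>'\<close> are estimated from below by their values at \<open>d = 1\<close> and, in the last one, \<open>M = 1\<close>.\<close>
  have "(10 * 1 * 1 * M) * 24 \<le> \<gamma>'"
    unfolding \<gamma>'_def
  proof (rule mult_mono)
    show "10 * 1 * 1 * M \<le> 10 * real CARD('n) * (2 * real CARD('n) - 1) * M"
      using d d' M by (intro mult_mono mult_nonneg_nonneg) linarith+
    have "8 * 3 * 1 \<le> 8 * (real CARD('n) + 2) * M"
      using d M by (intro mult_mono) auto
    then show "24 \<le> 8 * (real CARD('n) + 2) * M + 1" by simp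
    show "0 \<le> 10 * real CARD('n) * (2 * real CARD('n) - 1) * M"
      using d d' M by (intro mult_nonneg_nonneg) linarith+
  qed auto
  then have \<gamma>': "48 * M \<le> \<gamma>'" using M by simp
  obtain g where g: "smooth_line g" "\<And>x. 0 \<le> g x \<and> g x \<le> 1"
    "\<And>x. x \<le> 1 \<Longrightarrow> g x = 1" "\<And>x. 2 \<le> x \<Longrightarrow> g x = 0"
    "taylor_bounded (jet_weight L) (4 * M) g"
    using jet_weight_step[OF L_ge L_mono L_int M_def] by metis
  interpret bounded_smooth_step g "jet_weight L" "4 * M"
    by unfold_locales (use g M jet_weight_properties[OF L_ge L_mono] in auto)
  have le_1: "\<bar>cube_step 1 t\<bar> \<le> 1" "\<bar>trig_cutoff t\<bar> \<le> 1" for t :: "real^'n"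
    using cube_step_bounds[of 1 t] trig_cutoff_bounds[of t] by simp_all
  have a: "(cube_step 1 :: real^'n \<Rightarrow> real) \<in> S_class L 8 \<gamma>'"
    by (rule S_class_smooth_expr[OF cube_step_smooth _ _ _ L_ge le_1(1) cube_step_bounded])
      (use M \<gamma>' in auto)
  have c: "(trig_cutoff :: real^'n \<Rightarrow> real) \<in> S_class L 8 \<gamma>'"
    by (rule S_class_smooth_expr[OF trig_cutoff_smooth _ _ _ L_ge le_1(2) trig_cutoff_bounded])
      (use M \<gamma>' in auto)
  show ?thesis
    using a c cutoff_a_cube_step cutoff_c_trig_cutoff cube_step_bounds trig_cutoff_bounds
    unfolding cutoff_c_def by blast
qed

end
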